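(* Let $F$ be a fixed graph with no isolated vertices that contains an isolated edge. Then $rsat(n,F)=O(1)$ for all sufficiently large $n$; that is, there is a constant $c=c(F)$ such that $rsat(n,F)\le c$ for all sufficiently large $n$.
   Context: All graphs are finite, simple, undirected and have nonempty vertex set. $|G|$ and $e(G)$ denote the number of vertices and edges of $G$. An isolated edge of $F$ is a connected component of $F$ isomorphic to $K_2$. An edge-colored graph is a pair $(G,\mathcal C)$ with $\mathcal C:E(G)\to\mathbb N$ an arbitrary map (not necessarily a proper coloring). A subgraph is rainbow if its edges have pairwise distinct colors. For a nonedge $e$ of $G$ and $\alpha\in\mathbb N$, $(G,\mathcal C)+_\alpha e$ is the edge-colored graph obtained by adding $e$ with color $\alpha$. $(G,\mathcal C)$ is $F$-rainbow saturated if it contains no rainbow copy of $F$ (a copy is a not necessarily induced subgraph isomorphic to $F$) and, for every nonedge $e$ and every $\alpha\in\mathbb N$, $(G,\mathcal C)+_\alpha e$ contains a rainbow copy of $F$ containing $e$. $rsat(n,F)$ is the minimum of $e(G)$ over all graphs $G$ with $|G|=n$ such that $(G,\mathcal C)$ is $F$-rainbow saturated for some $\mathcal C$. *)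

theory Defs
  imports Main "HOL-Library.Extended_Nat"
begin

datatype 'v graph = Graph (verts: "'v set") (edges: "'v set set")

definition all_pairs :: "'v set \<Rightarrow> 'v set set" where
  "all_pairs V = {{u, v} | u v. u \<in> V \<and> v \<in> V \<and> u \<noteq> v}"

definition simple_graph :: "'v graph \<Rightarrow> bool" where
  "simple_graph G \<longleftrightarrow> finite (verts G) \<and> verts G \<noteq> {} \<and> edges G \<subseteq> all_pairs (verts G)"

definition graph_iso :: "'v graph \<Rightarrow> 'w graph \<Rightarrow> bool" (infix "\<simeq>" 50) where
  "G \<simeq> H \<longleftrightarrow> (\<exists>f. bij_betw f (verts G) (verts H) \<and>
     (\<forall>u\<in>verts G. \<forall>v\<in>verts G. {u, v} \<in> edges G \<longleftrightarrow> {f u, f v} \<in> edges H))"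

definition subgraph :: "'v graph \<Rightarrow> 'v graph \<Rightarrow> bool" where
  "subgraph H G \<longleftrightarrow> simple_graph H \<and> verts H \<subseteq> verts G \<and> edges H \<subseteq> edges G"

definition induced_subgraph :: "'v graph \<Rightarrow> 'v set \<Rightarrow> 'v graph" where
  "induced_subgraph G W = Graph W {e \<in> edges G. e \<subseteq> W}"

definition adjacent :: "'v graph \<Rightarrow> 'v \<Rightarrow> 'v \<Rightarrow> bool" where
  "adjacent G u v \<longleftrightarrow> {u, v} \<in> edges G"

definition component :: "'v graph \<Rightarrow> 'v graph \<Rightarrow> bool" where
  "component H G \<longleftrightarrow> (\<exists>v\<in>verts G. H = induced_subgraph G {w. (adjacent G)\<^sup>*\<^sup>* v w})"

definition isolated_vertex :: "'v \<Rightarrow> 'v graph \<Rightarrow> bool" where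
  "isolated_vertex v G \<longleftrightarrow> v \<in> verts G \<and> (\<forall>u\<in>verts G. \<not> adjacent G v u)"

definition complete_graph :: "nat \<Rightarrow> nat graph" where
  "complete_graph n = Graph {..<n} (all_pairs {..<n})"

definition isolated_edge :: "'v graph \<Rightarrow> 'v graph \<Rightarrow> bool" where
  "isolated_edge H G \<longleftrightarrow> component H G \<and> H \<simeq> complete_graph 2"

text \<open>
  An edge coloring of \<open>G\<close> is a total function on sets of vertices; only its values on
  \<open>edges G\<close> are ever used.
\<close>

type_synonym 'v coloring = "'v set \<Rightarrow> nat"

definition rainbow :: "'v coloring \<Rightarrow> 'v graph \<Rightarrow> bool" where
  "rainbow C H \<longleftrightarrow> inj_on C (edges H)"

definition rainbow_copy :: "'w graph \<Rightarrow> 'v graph \<Rightarrow> 'v coloring \<Rightarrow> 'v graph \<Rightarrow> bool" where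
  "rainbow_copy F G C H \<longleftrightarrow> subgraph H G \<and> H \<simeq> F \<and> rainbow C H"

definition add_edge :: "'v graph \<Rightarrow> 'v set \<Rightarrow> 'v graph" where
  "add_edge G e = Graph (verts G) (insert e (edges G))"

definition rainbow_saturated :: "'w graph \<Rightarrow> 'v graph \<Rightarrow> 'v coloring \<Rightarrow> bool" where
  "rainbow_saturated F G C \<longleftrightarrow>
     (\<nexists>H. rainbow_copy F G C H) \<and>
     (\<forall>e \<in> all_pairs (verts G) - edges G. \<forall>\<alpha>.
        \<exists>H. rainbow_copy F (add_edge G e) (C(e := \<alpha>)) H \<and> e \<in> edges H)"

text \<open>
  The host graphs live on finite sets of naturals, which covers all finite graphs up to
  isomorphism. The infimum in \<^typ>\<open>enat\<close> is a minimum whenever some saturated graph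
  on \<open>n\<close> vertices exists, and is \<open>\<infinity>\<close> otherwise, so that a finite upper bound on
  \<open>rsat n F\<close> includes the existence of such a graph.
\<close>

definition rsat :: "nat \<Rightarrow> 'w graph \<Rightarrow> enat" where
  "rsat n F = (INF G \<in> {G :: nat graph. simple_graph G \<and> card (verts G) = n \<and>
     (\<exists>C. rainbow_saturated F G C)}. enat (card (edges G)))"

end

theory Submission
  imports Defs "HOL-Library.Nat_Bijection"
begin

text \<open>
  Let \<open>R\<close> be what remains of \<open>F\<close> after deleting the isolated edge, and \<open>m = |R|\<close>. It suffices
  to find a bounded coloured core without rainbow \<open>F\<close> such that for every vertex \<open>v\<close> and
  every colour \<open>\<alpha>\<close> the core without \<open>v\<close> has a rainbow copy of \<open>R\<close> avoiding \<open>\<alpha>\<close>: add isolated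
  vertices, so that any new edge leaving the core completes a rainbow \<open>F\<close>, and then add edges to
  the core as long as no rainbow \<open>F\<close> arises.
  If \<open>R\<close> is not complete, a rainbow \<open>K\<close> on \<open>m + 1\<close> vertices is such a core: it is too small for
  \<open>F\<close>, and \<open>R\<close> embeds in a clique on \<open>m\<close> vertices minus any given edge.
  If \<open>R\<close> is complete, take the complete multipartite graph with \<open>m\<close> parts \<open>{2i, 2i+1}\<close>, and
  give two edges between the same parts the same colour iff they are equal or disjoint. A copy
  of \<open>R\<close> is then a transversal, and every edge disjoint from it has the colour of the
  opposite edge, which lies in the transversal.
\<close>

section \<open>Sets of unordered pairs\<close>

lemma all_pairs_iff: "{x, y} \<in> all_pairs V \<longleftrightarrow> x \<in> V \<and> y \<in> V \<and> x \<noteq> y"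
  unfolding all_pairs_def by (auto simp: doubleton_eq_iff)

lemma all_pairsE:
  assumes "e \<in> all_pairs V"
  obtains x y where "e = {x, y}" "x \<in> V" "y \<in> V" "x \<noteq> y"
  using assms unfolding all_pairs_def by blast

lemma all_pairs_mono: "V \<subseteq> W \<Longrightarrow> all_pairs V \<subseteq> all_pairs W"
  unfolding all_pairs_def by blast

lemma all_pairs_subset_Pow: "all_pairs V \<subseteq> Pow V"
  unfolding all_pairs_def by blast

lemma finite_all_pairs: "finite V \<Longrightarrow> finite (all_pairs V)"
  using all_pairs_subset_Pow finite_Pow_iff finite_subset by metis

lemma image_all_pairs:
  assumes "e \<in> all_pairs R" "inj_on f R" "f ` R \<subseteq> S"
  shows "f ` e \<in> all_pairs S"
proof -
  obtain x y where "e = {x, y}" "x \<in> R" "y \<in> R" "x \<noteq> y" using assms(1) by (rule all_pairsE)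
  moreover from this have "f x \<noteq> f y" using assms(2) by (metis inj_onD)
  ultimately show ?thesis using assms(3) by (auto simp: all_pairs_iff)
qed

section \<open>Rainbow copies as embeddings\<close>

text \<open>Maps out of \<open>F\<close> replace subgraphs of \<open>G\<close>: they can be altered
  by function updates, and the rainbow condition is stated on the fixed set
  \<open>edges F\<close>.\<close>

definition rainbow_emb ::
  "'a graph \<Rightarrow> 'v graph \<Rightarrow> 'v coloring \<Rightarrow> ('a \<Rightarrow> 'v) \<Rightarrow> bool" where
  "rainbow_emb F G C f \<longleftrightarrow> inj_on f (verts F) \<and> f ` verts F \<subseteq> verts G \<and>
     (\<forall>e\<in>edges F. f ` e \<in> edges G) \<and> inj_on (\<lambda>e. C (f ` e)) (edges F)"

lemma rainbow_copy_imp_emb: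
  assumes F: "simple_graph F" and H: "rainbow_copy F G C H"
  shows "\<exists>f. rainbow_emb F G C f"
proof -
  from H have sub: "subgraph H G" and rb: "inj_on C (edges H)"
    by (auto simp: rainbow_copy_def rainbow_def)
  from H obtain g where g: "bij_betw g (verts H) (verts F)"
    and ge: "\<And>u v. u \<in> verts H \<Longrightarrow> v \<in> verts H \<Longrightarrow> {u, v} \<in> edges H \<longleftrightarrow> {g u, g v} \<in> edges F"
    by (auto simp: rainbow_copy_def graph_iso_def)
  define f where "f = inv_into (verts H) g"
  have f: "bij_betw f (verts F) (verts H)"
    unfolding f_def using g by (rule bij_betw_inv_into)
  have gf: "g (f x) = x" if "x \<in> verts F" for x
    unfolding f_def using g that by (simp add: bij_betw_inv_into_right)
  have eF: "edges F \<subseteq> all_pairs (verts F)" using F by (simp add: simple_graph_def)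
  have fe: "f ` e \<in> edges H" if e: "e \<in> edges F" for e
  proof -
    obtain x y where xy: "e = {x, y}" "x \<in> verts F" "y \<in> verts F"
      using e eF all_pairsE[of e "verts F"] by blast
    have "f x \<in> verts H" "f y \<in> verts H" using f xy by (auto simp: bij_betw_def)
    with ge[of "f x" "f y"] e xy gf show ?thesis by simp
  qed
  have "inj_on ((`) f) (edges F)"
    using f eF all_pairs_subset_Pow inj_on_image_Pow inj_on_subset bij_betw_imp_inj_on
    by metis
  then have "inj_on (C \<circ> (`) f) (edges F)"
    by (rule comp_inj_on) (use rb fe in \<open>auto intro: inj_on_subset\<close>)
  then have "inj_on (\<lambda>e. C (f ` e)) (edges F)" by (simp add: comp_def)
  moreover have "inj_on f (verts F)" "f ` verts F \<subseteq> verts G"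
    using f sub by (auto simp: bij_betw_def subgraph_def)
  moreover have "\<forall>e\<in>edges F. f ` e \<in> edges G" using fe sub by (auto simp: subgraph_def)
  ultimately show ?thesis unfolding rainbow_emb_def by blast
qed

text \<open>The copy is named explicitly as the image of \<open>F\<close>, so that an added edge can
  later be shown to lie in it.\<close>

lemma rainbow_emb_imp_copy:
  assumes F: "simple_graph F" and f: "rainbow_emb F G C f"
  shows "rainbow_copy F G C (Graph (f ` verts F) ((`) f ` edges F))"
proof -
  let ?H = "Graph (f ` verts F) ((`) f ` edges F)"
  have eF: "edges F \<subseteq> all_pairs (verts F)" and VF: "finite (verts F)" "verts F \<noteq> {}"
    using F by (auto simp: simple_graph_def)
  from f have inj: "inj_on f (verts F)" and fV: "f ` verts F \<subseteq> verts G"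
    and fE: "\<And>e. e \<in> edges F \<Longrightarrow> f ` e \<in> edges G"
    and inC: "inj_on (\<lambda>e. C (f ` e)) (edges F)"
    by (auto simp: rainbow_emb_def)
  have "simple_graph ?H"
    using VF eF image_all_pairs[OF _ inj order_refl] by (auto simp: simple_graph_def)
  then have sub: "subgraph ?H G" using fV fE by (auto simp: subgraph_def)
  have injP: "inj_on ((`) f) (Pow (verts F))" using inj by (rule inj_on_image_Pow)
  have "{u, v} \<in> edges F \<longleftrightarrow> {f u, f v} \<in> (`) f ` edges F"
    if "u \<in> verts F" "v \<in> verts F" for u v
  proof -
    have "f ` {u, v} \<in> (`) f ` edges F \<longleftrightarrow> {u, v} \<in> edges F"
      using inj_on_image_mem_iff[OF injP, of "{u, v}" "edges F"] that eF
        all_pairs_subset_Pow[of "verts F"] by blast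
    then show ?thesis by simp
  qed
  moreover have "bij_betw f (verts F) (f ` verts F)" using inj by (simp add: bij_betw_def)
  ultimately have "F \<simeq> ?H" unfolding graph_iso_def by (intro exI[of _ f]) auto
  then obtain g where g: "bij_betw g (verts F) (verts ?H)"
    and ge: "\<And>u v. u \<in> verts F \<Longrightarrow> v \<in> verts F \<Longrightarrow> {u, v} \<in> edges F \<longleftrightarrow> {g u, g v} \<in> edges ?H"
    by (auto simp: graph_iso_def)
  have "?H \<simeq> F" unfolding graph_iso_def
  proof (intro exI[of _ "inv_into (verts F) g"] conjI ballI)
    show "bij_betw (inv_into (verts F) g) (verts ?H) (verts F)"
      using g by (rule bij_betw_inv_into)
    fix u v assume "u \<in> verts ?H" "v \<in> verts ?H"
    then show "({u, v} \<in> edges ?H) =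
        ({inv_into (verts F) g u, inv_into (verts F) g v} \<in> edges F)"
      using ge[of "inv_into (verts F) g u" "inv_into (verts F) g v"] g
      by (metis bij_betw_def bij_betw_inv_into_right inv_into_into)
  qed
  moreover have "rainbow C ?H" using inC by (auto simp: rainbow_def inj_on_def)
  ultimately show ?thesis using sub by (simp add: rainbow_copy_def)
qed

section \<open>Splitting off the isolated edge\<close>

text \<open>A component is closed under adjacency, so an edge that meets \<open>{a, b}\<close> has
  both ends there and equals \<open>{a, b}\<close>.\<close>

lemma isolated_edge_ends:
  assumes F: "simple_graph F" and iso: "isolated_edge H F"
  obtains a b where "a \<noteq> b" "a \<in> verts F" "b \<in> verts F" "{a, b} \<in> edges F"
    "edges F - {{a, b}} \<subseteq> all_pairs (verts F - {a, b})"
proof -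
  have eF: "edges F \<subseteq> all_pairs (verts F)" using F by (simp add: simple_graph_def)
  obtain v where H: "H = induced_subgraph F {w. (adjacent F)\<^sup>*\<^sup>* v w}"
    and iso2: "H \<simeq> complete_graph 2"
    using iso by (auto simp: isolated_edge_def component_def)
  define W where "W = {w. (adjacent F)\<^sup>*\<^sup>* v w}"
  have closed: "y \<in> W" if "x \<in> W" "{x, y} \<in> edges F" for x y
    using that unfolding W_def
    by (auto intro: rtranclp.rtrancl_into_rtrancl simp: adjacent_def)
  obtain f where f: "bij_betw f W {..<2::nat}"
    and fe: "\<And>x y. x \<in> W \<Longrightarrow> y \<in> W \<Longrightarrow>
      {x, y} \<in> {e \<in> edges F. e \<subseteq> W} \<longleftrightarrow> {f x, f y} \<in> all_pairs {..<2::nat}"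
    using iso2 unfolding H W_def[symmetric]
    by (auto simp: graph_iso_def induced_subgraph_def complete_graph_def)
  have "card W = 2" using f by (simp add: bij_betw_same_card)
  then obtain a b where W: "W = {a, b}" and ab: "a \<noteq> b" by (auto simp: card_2_iff)
  have "f a \<in> {..<2}" "f b \<in> {..<2}" "f a \<noteq> f b"
    using f W ab by (auto simp: bij_betw_def inj_on_def)
  then have abE: "{a, b} \<in> edges F" using fe[of a b] W by (simp add: all_pairs_iff)
  have "e \<in> all_pairs (verts F - {a, b})" if e: "e \<in> edges F - {{a, b}}" for e
  proof -
    obtain x y where xy: "e = {x, y}" "x \<in> verts F" "y \<in> verts F" "x \<noteq> y"
      using e eF all_pairsE[of e "verts F"] by blast
    have "x \<notin> W" "y \<notin> W"
      using closed[of x y] closed[of y x] e xy W by (auto simp: insert_commute)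
    then show ?thesis using xy W by (simp add: all_pairs_iff)
  qed
  moreover have "a \<in> verts F" "b \<in> verts F"
    using abE eF by (auto simp: all_pairs_iff dest: subsetD)
  ultimately show ?thesis using that ab abE by blast
qed

section \<open>From a core to a saturated graph\<close>

text \<open>Inside the core, a rainbow-\<open>F\<close>-free supergraph with the maximum number of edges is
  saturated; it has no edge leaving the core because the core with such an edge has a rainbow \<open>F\<close>.\<close>

lemma rsat_le_of_core:
  fixes F :: "'a graph" and E0 :: "nat set set"
  assumes F: "simple_graph F"
    and Kn: "K \<subseteq> {..<n}" and n: "0 < n"
    and E0: "E0 \<subseteq> all_pairs K"
    and free: "\<nexists>f. rainbow_emb F (Graph {..<n} E0) C0 f"
    and ext: "\<And>e \<alpha>. e \<in> all_pairs {..<n} - all_pairs K \<Longrightarrow>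
      \<exists>f. rainbow_emb F (Graph {..<n} (insert e E0)) (C0(e := \<alpha>)) f"
  shows "rsat n F \<le> enat (card (all_pairs K))"
proof -
  let ?V = "{..<n}"
  \<comment> \<open>Edge set and colouring are chosen together, so a new edge may come with any
    colour. The colours on \<open>E0\<close> stay fixed because \<open>ext\<close> is stated for
    \<open>C0\<close>.\<close>
  define ok where "ok p \<longleftrightarrow> E0 \<subseteq> fst p \<and> fst p \<subseteq> all_pairs ?V \<and>
    (\<forall>e\<in>E0. snd p e = C0 e) \<and> (\<nexists>f. rainbow_emb F (Graph ?V (fst p)) (snd p) f)"
    for p :: "nat set set \<times> nat coloring"
  have finV: "finite (all_pairs ?V)" by (simp add: finite_all_pairs)
  have finK: "finite (all_pairs K)"
    using Kn finite_subset finite_all_pairs finite_lessThan by metis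
  have "ok (E0, C0)"
    using E0 Kn all_pairs_mono[OF Kn] free by (auto simp: ok_def)
  moreover have "\<forall>p. ok p \<longrightarrow> card (fst p) < Suc (card (all_pairs ?V))"
    using finV by (auto simp: ok_def less_Suc_eq_le intro!: card_mono)
  ultimately obtain p where p: "ok p" and max: "\<And>q. ok q \<Longrightarrow> card (fst q) \<le> card (fst p)"
    using ex_has_greatest_nat[of ok "(E0, C0)" "\<lambda>p. card (fst p)"] by blast
  obtain E C where pEC: "p = (E, C)" by fastforce
  from p have E: "E0 \<subseteq> E" "E \<subseteq> all_pairs ?V" and C: "\<And>e. e \<in> E0 \<Longrightarrow> C e = C0 e"
    and EC: "\<And>f. \<not> rainbow_emb F (Graph ?V E) C f" by (auto simp: ok_def pEC)
  have "E \<subseteq> all_pairs K"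
  proof
    fix e assume e: "e \<in> E"
    show "e \<in> all_pairs K"
    proof (rule ccontr)
      assume "e \<notin> all_pairs K"
      \<comment> \<open>With \<open>C e\<close> as the colour of \<open>e\<close>, the colouring in
        \<open>ext\<close> agrees with \<open>C\<close> on \<open>insert e E0\<close>, a subset of
        \<open>E\<close>; the embedding thus carries over to \<open>E\<close>.\<close>
      then obtain f where
        f: "rainbow_emb F (Graph ?V (insert e E0)) (C0(e := C e)) f"
        using ext[of e "C e"] e E by blast
      have "(C0(e := C e)) e' = C e'" if "e' \<in> insert e E0" for e'
        using that C by auto
      then have "inj_on (\<lambda>e'. C (f ` e')) (edges F)"
        using f unfolding rainbow_emb_def graph.sel
        by (metis (mono_tags, lifting) inj_on_cong)
      then have "rainbow_emb F (Graph ?V E) C f"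
        using f e E by (auto simp: rainbow_emb_def)
      then show False using EC by blast
    qed
  qed
  then have card: "card E \<le> card (all_pairs K)" using finK by (rule card_mono[rotated])
  have "rainbow_saturated F (Graph ?V E) C"
    unfolding rainbow_saturated_def
  proof (intro conjI ballI allI)
    show "\<nexists>H. rainbow_copy F (Graph ?V E) C H"
      using rainbow_copy_imp_emb[OF F] EC by blast
    fix e \<alpha> assume "e \<in> all_pairs (verts (Graph ?V E)) - edges (Graph ?V E)"
    then have e: "e \<in> all_pairs ?V" "e \<notin> E" by auto
    \<comment> \<open>The new pair has one more edge than the maximum. Every other clause of
      \<open>ok\<close> still holds, so it must be rainbow-\<open>F\<close>-freeness that
      fails.\<close>
    have "\<not> ok (insert e E, C(e := \<alpha>))"
      using max[of "(insert e E, C(e := \<alpha>))"] e finite_subset[OF E(2) finV]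
      by (auto simp: pEC)
    moreover have "e' \<noteq> e" if "e' \<in> E0" for e' using that e E by auto
    ultimately obtain f where f: "rainbow_emb F (Graph ?V (insert e E)) (C(e := \<alpha>)) f"
      using E e C by (auto simp: ok_def)
    \<comment> \<open>A copy avoiding \<open>e\<close> would already be rainbow in \<open>E\<close>
      under \<open>C\<close>.\<close>
    have "e \<in> (`) f ` edges F"
    proof (rule ccontr)
      assume ne: "e \<notin> (`) f ` edges F"
      have "inj_on (\<lambda>e'. C (f ` e')) (edges F)"
      proof (rule inj_on_cong[THEN iffD1])
        show "inj_on (\<lambda>e'. (C(e := \<alpha>)) (f ` e')) (edges F)"
          using f by (simp add: rainbow_emb_def)
      qed (use ne in auto)
      then have "rainbow_emb F (Graph ?V E) C f"
        using f ne by (auto simp: rainbow_emb_def)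
      then show False using EC by blast
    qed
    then show "\<exists>H. rainbow_copy F (add_edge (Graph ?V E) e) (C(e := \<alpha>)) H \<and> e \<in> edges H"
      using rainbow_emb_imp_copy[OF F f] by (auto simp: add_edge_def)
  qed
  moreover have "simple_graph (Graph ?V E)" using E n by (auto simp: simple_graph_def)
  ultimately have "rsat n F \<le> enat (card (edges (Graph ?V E)))"
    unfolding rsat_def by (intro INF_lower) auto
  also have "\<dots> \<le> enat (card (all_pairs K))" using card by simp
  finally show ?thesis .
qed

text \<open>The isolated edge of \<open>F\<close> is mapped onto the new edge and \<open>R\<close>
  into the core. The new edge may have one end \<open>v\<close> in the core and carries an arbitrary
  colour \<open>\<alpha>\<close>; this is why \<open>robust\<close> must avoid both. The bound
  depends on \<open>k\<close> only.\<close>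

lemma rsat_bounded_of_robust_core:
  fixes F :: "'a graph" and E0 :: "nat set set"
  assumes F: "simple_graph F" and noiso: "\<nexists>v. isolated_vertex v F"
    and ab: "a \<noteq> b" "{a, b} \<in> edges F" "R = verts F - {a, b}"
      "edges F - {{a, b}} \<subseteq> all_pairs R"
    and E0: "E0 \<subseteq> all_pairs {..<k}"
    and free: "\<nexists>f. rainbow_emb F (Graph {..<k} E0) C0 f"
    and robust: "\<And>v \<alpha>. \<exists>g. inj_on g R \<and> g ` R \<subseteq> {..<k} - {v} \<and>
      (\<forall>e\<in>edges F - {{a, b}}. g ` e \<in> E0 \<and> C0 (g ` e) \<noteq> \<alpha>) \<and>
      inj_on (\<lambda>e. C0 (g ` e)) (edges F - {{a, b}})"
  shows "\<exists>c::nat. \<exists>N::nat. \<forall>n\<ge>N. rsat n F \<le> enat c"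
proof (intro exI allI impI)
  fix n assume n: "Suc k \<le> n"
  show "rsat n F \<le> enat (card (all_pairs {..<k}))"
  proof (rule rsat_le_of_core[OF F _ _ E0])
    show "{..<k} \<subseteq> {..<n}" "0 < n" using n by auto
    \<comment> \<open>Each vertex of \<open>F\<close> lies on an edge, whose image is an edge of the
      core; the added isolated vertices are never hit.\<close>
    have "rainbow_emb F (Graph {..<k} E0) C0 f"
      if f: "rainbow_emb F (Graph {..<n} E0) C0 f" for f
    proof -
      have "f x \<in> {..<k}" if x: "x \<in> verts F" for x
      proof -
        obtain y where "{x, y} \<in> edges F"
          using noiso x by (auto simp: isolated_vertex_def adjacent_def)
        then have "{f x, f y} \<in> all_pairs {..<k}"
          using f E0 by (force simp: rainbow_emb_def)
        then show ?thesis by (simp add: all_pairs_iff)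
      qed
      then show ?thesis using f by (auto simp: rainbow_emb_def)
    qed
    then show "\<nexists>f. rainbow_emb F (Graph {..<n} E0) C0 f" using free by blast
    fix e \<alpha> assume e: "e \<in> all_pairs {..<n} - all_pairs {..<k}"
    \<comment> \<open>The ends are named so that \<open>u\<close> is outside the core. Since
      \<open>w\<close> may be inside, it has to be kept out of the copy of \<open>R\<close>.\<close>
    obtain u w where uw: "e = {u, w}" "u < n" "w < n" "u \<noteq> w" "u \<notin> {..<k}"
    proof -
      obtain x y where xy: "e = {x, y}" "x \<in> {..<n}" "y \<in> {..<n}" "x \<noteq> y"
        using e by (auto elim: all_pairsE)
      then consider "x \<notin> {..<k}" | "y \<notin> {..<k}" using e by (auto simp: all_pairs_iff)
      then show ?thesis
        by cases (use that[of x y] that[of y x] xy in \<open>auto simp: insert_commute\<close>)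
    qed
    obtain g where g: "inj_on g R" "g ` R \<subseteq> {..<k} - {w}"
      and gE: "\<And>e'. e' \<in> edges F - {{a, b}} \<Longrightarrow> g ` e' \<in> E0 \<and> C0 (g ` e') \<noteq> \<alpha>"
      and gC: "inj_on (\<lambda>e'. C0 (g ` e')) (edges F - {{a, b}})"
      using robust[of w \<alpha>] by blast
    define f where "f = g(a := u, b := w)"
    have fab: "f ` {a, b} = e" using ab uw by (auto simp: f_def)
    have fR: "f x = g x" if "x \<in> R" for x using that ab by (auto simp: f_def)
    have fe: "f ` e' = g ` e'" if "e' \<in> edges F - {{a, b}}" for e'
      using that ab(4) all_pairs_subset_Pow[of R] fR by (intro image_cong) auto
    have ne: "e' \<noteq> e" if "e' \<in> E0" for e' using that e E0 by auto
    have "{a, b} \<in> all_pairs (verts F)" using ab(2) F by (auto simp: simple_graph_def)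
    then have VF: "verts F = insert a (insert b R)" using ab(3) by (auto simp: all_pairs_iff)
    have "inj_on f R" using g(1) fR by (simp cong: inj_on_cong)
    moreover have "f ` R = g ` R" using fR by simp
    moreover have "f a = u" "f b = w" using ab by (auto simp: f_def)
    moreover have "u \<notin> g ` R" "w \<notin> g ` R" using g(2) uw by auto
    moreover have "a \<notin> R" "b \<notin> R" using ab by auto
    ultimately have inj: "inj_on f (verts F)"
      unfolding VF using uw by (auto simp: inj_on_insert)
    have im: "f ` verts F \<subseteq> {..<n}"
    proof -
      have "f ` R \<subseteq> {..<k}" using g(2) \<open>f ` R = g ` R\<close> by auto
      then have "f ` R \<subseteq> {..<n}" using n by force
      then show ?thesis using \<open>f a = u\<close> \<open>f b = w\<close> uw by (simp add: VF)
    qed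
    have EF: "edges F = insert {a, b} (edges F - {{a, b}})" using ab by auto
    have col: "(C0(e := \<alpha>)) (f ` e') = C0 (g ` e')" if "e' \<in> edges F - {{a, b}}" for e'
      using that fe[OF that] gE[OF that] ne by auto
    have "inj_on (\<lambda>e'. (C0(e := \<alpha>)) (f ` e')) (edges F - {{a, b}})"
      by (rule iffD2[OF inj_on_cong[OF col] gC])
    moreover have "(C0(e := \<alpha>)) (f ` {a, b}) = \<alpha>" by (simp only: fab fun_upd_same)
    moreover have "\<alpha> \<notin> (\<lambda>e'. (C0(e := \<alpha>)) (f ` e')) ` (edges F - {{a, b}})"
      using col gE by (metis (no_types, lifting) imageE)
    ultimately have "inj_on (\<lambda>e'. (C0(e := \<alpha>)) (f ` e')) (edges F)"
      by (subst EF, subst inj_on_insert) auto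
    moreover have "f ` e' \<in> insert e E0" if "e' \<in> edges F" for e'
      using that fab fe gE by (cases "e' = {a, b}") auto
    ultimately show "\<exists>f. rainbow_emb F (Graph {..<n} (insert e E0)) (C0(e := \<alpha>)) f"
      using inj im unfolding rainbow_emb_def by (intro exI[of _ f]) auto
  qed
qed

section \<open>The rainbow clique as a core\<close>

lemma set_encode_inj_all_pairs: "inj_on set_encode (all_pairs {..<k})"
  using inj_on_set_encode by (rule inj_on_subset) (auto simp: all_pairs_def)

text \<open>The extra vertex leaves room to avoid \<open>v\<close>. To avoid
  \<open>\<alpha>\<close>, a nonedge \<open>{x, y}\<close> of \<open>R\<close> is placed on the pair
  of that colour, of which there is at most one.\<close>

lemma clique_core_robust:
  assumes R: "finite R" and E: "E \<subset> all_pairs R"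
  shows "\<exists>g. inj_on g R \<and> g ` R \<subseteq> {..<Suc (card R)} - {v} \<and>
    (\<forall>e\<in>E. g ` e \<in> all_pairs {..<Suc (card R)} \<and> set_encode (g ` e) \<noteq> \<alpha>) \<and>
    inj_on (\<lambda>e. set_encode (g ` e)) E"
proof -
  let ?K = "{..<Suc (card R)}"
  obtain x y where xy: "{x, y} \<notin> E" "x \<in> R" "y \<in> R" "x \<noteq> y"
    using E unfolding all_pairs_def by blast
  have "card R \<le> card (?K - {v})" by (simp add: card_Diff_singleton_if)
  then obtain S where S: "S \<subseteq> ?K - {v}" "card S = card R" "finite S"
    by (meson obtain_subset_with_card_n)
  have "card {x, y} \<le> card R" using xy R by (intro card_mono) auto
  then have "2 \<le> card S" using S xy by simp
  then obtain T where "T \<subseteq> S" "card T = 2" by (meson obtain_subset_with_card_n)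
  then have "\<exists>p. p \<in> all_pairs S" by (auto simp: card_2_iff all_pairs_def)
  \<comment> \<open>\<open>p\<close> is the pair coloured \<open>\<alpha>\<close> if
    \<open>S\<close> has one, and any pair otherwise; the implication covers both cases.\<close>
  then have "\<exists>p\<in>all_pairs S. (\<forall>q\<in>all_pairs S. set_encode q = \<alpha> \<longrightarrow> set_encode p = \<alpha>)"
    by blast
  then obtain s t where st: "s \<in> S" "t \<in> S" "s \<noteq> t"
    and only: "\<And>q. q \<in> all_pairs S \<Longrightarrow> set_encode q = \<alpha> \<Longrightarrow> set_encode {s, t} = \<alpha>"
    by (metis all_pairsE)
  have "card (R - {x, y}) = card (S - {s, t})"
    using xy st S R by (simp add: card_Diff_subset)
  then obtain h where h: "bij_betw h (R - {x, y}) (S - {s, t})"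
    using R S(3) finite_same_card_bij by blast
  define g where "g = h(x := s, y := t)"
  have gst: "g x = s" "g y = t" using xy by (auto simp: g_def)
  have gh: "g z = h z" if "z \<in> R - {x, y}" for z using that by (auto simp: g_def)
  have "bij_betw g (R - {x, y}) (S - {s, t})"
    by (rule iffD2[OF bij_betw_cong[OF gh] h])
  moreover have "bij_betw g {x, y} {s, t}" using gst st by (auto simp: bij_betw_def)
  ultimately have "bij_betw g ((R - {x, y}) \<union> {x, y}) ((S - {s, t}) \<union> {s, t})"
    by (rule bij_betw_combine) auto
  moreover have "(R - {x, y}) \<union> {x, y} = R" "(S - {s, t}) \<union> {s, t} = S" using xy st by auto
  ultimately have g: "bij_betw g R S" by metis
  then have inj: "inj_on g R" and im: "g ` R = S" by (auto simp: bij_betw_def)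
  have SK: "all_pairs S \<subseteq> all_pairs ?K" using S by (intro all_pairs_mono) auto
  have gE: "g ` e \<in> all_pairs S" if "e \<in> E" for e
    using image_all_pairs[OF _ inj, of e S] that E im by auto
  have injI: "inj_on ((`) g) (Pow R)" using inj by (rule inj_on_image_Pow)
  have EP: "E \<subseteq> Pow R" using E all_pairs_subset_Pow by blast
  have "set_encode (g ` e) \<noteq> \<alpha>" if e: "e \<in> E" for e
  proof
    assume "set_encode (g ` e) = \<alpha>"
    then have "set_encode (g ` e) = set_encode {s, t}" using only gE[OF e] by simp
    moreover have "{s, t} \<in> all_pairs S" using st by (simp add: all_pairs_iff)
    ultimately have "g ` e = {s, t}"
      using gE[OF e] SK set_encode_inj_all_pairs by (metis inj_onD subsetD)
    then have "g ` e = g ` {x, y}" using gst by simp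
    moreover have "e \<in> Pow R" "{x, y} \<in> Pow R" using e EP xy by auto
    ultimately have "e = {x, y}" using injI by (metis inj_onD)
    then show False using e xy by simp
  qed
  moreover have "inj_on (\<lambda>e. set_encode (g ` e)) E"
  proof -
    have "inj_on (set_encode \<circ> (`) g) E"
      using inj_on_subset[OF injI EP]
      by (rule comp_inj_on)
        (use gE SK in \<open>auto intro!: inj_on_subset[OF set_encode_inj_all_pairs]\<close>)
    then show ?thesis by (simp add: comp_def)
  qed
  ultimately show ?thesis using inj im S gE SK by (intro exI[of _ g]) auto
qed

section \<open>The cocktail party graph as a core\<close>

text \<open>The core for complete \<open>R\<close>; the part of the vertex \<open>x\<close> is \<open>x div 2\<close>.\<close>

definition cocktail_edges :: "nat \<Rightarrow> nat set set" where
  "cocktail_edges m = {{x, y} | x y. x < 2 * m \<and> y < 2 * m \<and> x div 2 \<noteq> y div 2}"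

text \<open>Between two fixed parts, the parity of the sum of the ends splits the four edges into
  two opposite pairs: it is kept when both ends move to the other vertex of their part and changes
  when only one does.\<close>

definition cocktail_coloring :: "nat coloring" where
  "cocktail_coloring e = prod_encode (set_encode ((\<lambda>x. x div 2) ` e), \<Sum>e mod 2)"

lemma cocktail_edges_iff:
  "{x, y} \<in> cocktail_edges m \<longleftrightarrow> x < 2 * m \<and> y < 2 * m \<and> x div 2 \<noteq> y div 2"
  unfolding cocktail_edges_def by (auto simp: doubleton_eq_iff)

lemma cocktail_edges_subset: "cocktail_edges m \<subseteq> all_pairs {..<2 * m}"
  unfolding cocktail_edges_def all_pairs_def by auto

lemma cocktail_coloring_pair:
  assumes "x \<noteq> y"
  shows "cocktail_coloring {x, y} = prod_encode (set_encode {x div 2, y div 2}, (x + y) mod 2)"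
  using assms by (simp add: cocktail_coloring_def)

lemma set_encode_eq_iff: "finite A \<Longrightarrow> finite B \<Longrightarrow> set_encode A = set_encode B \<longleftrightarrow> A = B"
  by (metis set_encode_inverse)

lemma add_mod_2_flip:
  fixes u v x y :: nat
  assumes "u mod 2 = (x + 1) mod 2" "v mod 2 = (y + 1) mod 2"
  shows "(u + v) mod 2 = (x + y) mod 2"
proof -
  have "(u + v) mod 2 = (u mod 2 + v mod 2) mod 2" by (rule mod_add_eq[symmetric])
  also have "\<dots> = ((x + 1) + (y + 1)) mod 2" unfolding assms by (rule mod_add_eq)
  also have "(x + 1) + (y + 1) = (x + y) + 2" by simp
  also have "\<dots> mod 2 = (x + y) mod 2" by (rule mod_add_self2)
  finally show ?thesis .
qed

lemma cocktail_core_free: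
  assumes F: "simple_graph F"
    and ab: "a \<noteq> b" "{a, b} \<in> edges F" "R = verts F - {a, b}"
      "edges F - {{a, b}} = all_pairs R"
  shows "\<not> rainbow_emb F (Graph {..<2 * card R} (cocktail_edges (card R))) cocktail_coloring f"
proof
  assume f: "rainbow_emb F (Graph {..<2 * card R} (cocktail_edges (card R))) cocktail_coloring f"
  have "{a, b} \<in> all_pairs (verts F)" using ab(2) F by (auto simp: simple_graph_def)
  then have VF: "a \<in> verts F" "b \<in> verts F" by (simp_all add: all_pairs_iff)
  from f have inj: "inj_on f (verts F)" and rng: "f ` verts F \<subseteq> {..<2 * card R}"
    and fE': "\<forall>e\<in>edges F. f ` e \<in> cocktail_edges (card R)"
    and rb: "inj_on (\<lambda>e. cocktail_coloring (f ` e)) (edges F)"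
    by (simp_all add: rainbow_emb_def)
  have im: "f x < 2 * card R" if "x \<in> verts F" for x using that rng by auto
  have fE: "{f x, f y} \<in> cocktail_edges (card R)" if "{x, y} \<in> edges F" for x y
    using bspec[OF fE' that] by simp
  define h where "h x = f x div 2" for x
  have "inj_on h R"
  proof (rule inj_onI, rule ccontr)
    fix x y assume xy: "x \<in> R" "y \<in> R" "h x = h y" "x \<noteq> y"
    then have "{x, y} \<in> all_pairs R" by (simp add: all_pairs_iff)
    then have "{x, y} \<in> edges F" using ab(4) by blast
    from fE[OF this] show False using xy(3) by (simp add: cocktail_edges_iff h_def)
  qed
  moreover have hlt: "h x < card R" if "x \<in> verts F" for x
    unfolding h_def using im[OF that] by linarith
  then have "h ` R \<subseteq> {..<card R}" using ab(3) by auto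
  \<comment> \<open>Vertices of the complete \<open>R\<close> go to distinct parts, and there are
    only \<open>card R\<close> parts, so every part is hit.\<close>
  ultimately have hR: "h ` R = {..<card R}"
    by (metis card_image card_lessThan card_subset_eq finite_lessThan)
  \<comment> \<open>The part of \<open>f c\<close> already contains some \<open>f r\<close>, so
    \<open>f c\<close> is the other vertex of that part and has the other parity.\<close>
  have opposite: "\<exists>r\<in>R. h r = h c \<and> f c mod 2 = (f r + 1) mod 2"
    if c: "c \<in> verts F" "c \<notin> R" for c
  proof -
    obtain r where r: "r \<in> R" "h r = h c" using hlt[OF c(1)] hR by (metis imageE lessThan_iff)
    then have "f r \<noteq> f c" using inj c ab(3) by (metis DiffD1 inj_onD)
    moreover have "f r div 2 = f c div 2" using r by (simp add: h_def)
    ultimately have "f r mod 2 \<noteq> f c mod 2" by (metis div_mult_mod_eq)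
    then have "f c mod 2 = (f r + 1) mod 2" by (simp add: mod2_eq_if split: if_splits)
    then show ?thesis using r by blast
  qed
  obtain r where r: "r \<in> R" "h r = h a" "f a mod 2 = (f r + 1) mod 2"
    using opposite[of a] VF ab by auto
  obtain s where s: "s \<in> R" "h s = h b" "f b mod 2 = (f s + 1) mod 2"
    using opposite[of b] VF ab by auto
  \<comment> \<open>As \<open>a\<close> and \<open>b\<close> are adjacent, their images lie in
    different parts. Hence \<open>r\<close> and \<open>s\<close> differ and span an edge of the
    complete \<open>R\<close>, whose image is opposite to that of \<open>{a, b}\<close>.\<close>
  have hab: "h a \<noteq> h b" using fE[OF ab(2)] by (simp add: cocktail_edges_iff h_def)
  then have "r \<noteq> s" "f a \<noteq> f b" "f r \<noteq> f s" using r s by (auto simp: h_def)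
  then have rs: "{r, s} \<in> edges F" "{r, s} \<noteq> {a, b}"
  proof -
    have "{r, s} \<in> all_pairs R" using r(1) s(1) \<open>r \<noteq> s\<close> by (simp add: all_pairs_iff)
    then have "{r, s} \<in> edges F - {{a, b}}" unfolding ab(4) .
    then show "{r, s} \<in> edges F" "{r, s} \<noteq> {a, b}" by simp_all
  qed
  have "(f a + f b) mod 2 = (f r + f s) mod 2"
    using r(3) s(3) by (rule add_mod_2_flip)
  then have "cocktail_coloring (f ` {a, b}) = cocktail_coloring (f ` {r, s})"
    using r s \<open>f a \<noteq> f b\<close> \<open>f r \<noteq> f s\<close> by (simp add: cocktail_coloring_pair h_def)
  then show False using inj_onD[OF rb _ ab(2) rs(1)] rs(2) by simp
qed

text \<open>A transversal picks one of two vertices in each part. Avoiding \<open>v\<close> fixes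
  the pick in one part only. The colour \<open>\<alpha>\<close> belongs to at most one pair of
  parts, and the pick in one of these is still free to give the wrong parity.\<close>

lemma cocktail_core_robust:
  assumes R: "finite R"
  shows "\<exists>g. inj_on g R \<and> g ` R \<subseteq> {..<2 * card R} - {v} \<and>
    (\<forall>e\<in>all_pairs R. g ` e \<in> cocktail_edges (card R) \<and> cocktail_coloring (g ` e) \<noteq> \<alpha>) \<and>
    inj_on (\<lambda>e. cocktail_coloring (g ` e)) (all_pairs R)"
proof -
  obtain h where h: "bij_betw h R {..<card R}"
    using R by (metis finite_same_card_bij card_lessThan finite_lessThan)
  have hinj: "inj_on h R" and hlt: "\<And>x. x \<in> R \<Longrightarrow> h x < card R"
    using h by (auto simp: bij_betw_def)
  obtain s :: "nat \<Rightarrow> nat" where s: "\<And>i. s i < 2" "s (v div 2) \<noteq> v mod 2"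
    and s\<alpha>: "\<And>i j. i \<noteq> j \<Longrightarrow> prod_encode (set_encode {i, j}, (s i + s j) mod 2) \<noteq> \<alpha>"
  proof -
    \<comment> \<open>In the part of \<open>v\<close> the vertex other than \<open>v\<close> is
      picked; elsewhere the pick 0 is arbitrary.\<close>
    define s0 where "s0 = (\<lambda>_. 0)(v div 2 := 1 - v mod 2)"
    have s0: "s0 i < 2" "s0 (v div 2) \<noteq> v mod 2" for i
      by (auto simp: s0_def mod2_eq_if)
    show thesis
    proof (cases "\<exists>i j b. i \<noteq> j \<and> \<alpha> = prod_encode (set_encode {i, j}, b)")
      case False
      then show ?thesis using that[of s0] s0 by blast
    next
      case True
      \<comment> \<open>By the symmetry of \<open>{i, j}\<close>, \<open>j\<close> can be taken
        different from the part of \<open>v\<close>, so that changing the pick at \<open>j\<close>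
        does not bring \<open>v\<close> back.\<close>
      then obtain i j b where ij: "i \<noteq> j" "j \<noteq> v div 2"
        and \<alpha>: "\<alpha> = prod_encode (set_encode {i, j}, b)"
        by (metis insert_commute)
      \<comment> \<open>The picks at \<open>i\<close> and \<open>j\<close> now add up to
        \<open>b + 1\<close> modulo 2, which rules out \<open>b\<close>.\<close>
      define s where "s = s0(j := (s0 i + b + 1) mod 2)"
      have par: "(s i + s j) mod 2 \<noteq> b"
        using ij by (auto simp: s_def mod2_eq_if odd_pos)
      show ?thesis
      proof (rule that[of s])
        show "s i < 2" for i using s0 by (simp add: s_def)
        show "s (v div 2) \<noteq> v mod 2" using s0 ij by (simp add: s_def)
        fix i' j' :: nat assume "i' \<noteq> j'"
        show "prod_encode (set_encode {i', j'}, (s i' + s j') mod 2) \<noteq> \<alpha>"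
          using par by (auto simp: \<alpha> set_encode_eq_iff doubleton_eq_iff add.commute)
      qed
    qed
  qed
  define g where "g x = 2 * h x + s (h x)" for x
  have gdiv: "g x div 2 = h x" for x using s(1)[of "h x"] by (simp add: g_def)
  have gmod: "g x mod 2 = s (h x)" for x using s(1)[of "h x"] by (simp add: g_def)
  have ginj: "inj_on g R" using hinj gdiv by (metis inj_on_def)
  have glt: "g x < 2 * card R" if "x \<in> R" for x
    using hlt[OF that] gdiv[of x] by linarith
  have "g x \<noteq> v" for x using gdiv[of x] gmod[of x] s(2) by auto
  then have im: "g ` R \<subseteq> {..<2 * card R} - {v}" using glt by auto
  have col: "cocktail_coloring (g ` {x, y}) =
      prod_encode (set_encode {h x, h y}, (s (h x) + s (h y)) mod 2)" "h x \<noteq> h y"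
    if xy: "x \<in> R" "y \<in> R" "x \<noteq> y" for x y
  proof -
    show ne: "h x \<noteq> h y" using hinj xy by (metis inj_onD)
    then have "g x \<noteq> g y" using gdiv by metis
    moreover have "(g x + g y) mod 2 = (s (h x) + s (h y)) mod 2"
      using gmod by (metis mod_add_eq)
    ultimately show "cocktail_coloring (g ` {x, y}) =
      prod_encode (set_encode {h x, h y}, (s (h x) + s (h y)) mod 2)"
      by (simp add: cocktail_coloring_pair gdiv)
  qed
  have "g ` e \<in> cocktail_edges (card R) \<and> cocktail_coloring (g ` e) \<noteq> \<alpha>"
    if e: "e \<in> all_pairs R" for e
  proof -
    obtain x y where xy: "e = {x, y}" "x \<in> R" "y \<in> R" "x \<noteq> y" using e by (rule all_pairsE)
    show ?thesis
      using col[OF xy(2-4)] s\<alpha> glt xy gdiv by (auto simp: cocktail_edges_iff)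
  qed
  moreover have "inj_on (\<lambda>e. cocktail_coloring (g ` e)) (all_pairs R)"
  proof (rule inj_onI)
    fix e e' assume e: "e \<in> all_pairs R" "e' \<in> all_pairs R"
      and eq: "cocktail_coloring (g ` e) = cocktail_coloring (g ` e')"
    obtain x y where xy: "e = {x, y}" "x \<in> R" "y \<in> R" "x \<noteq> y" using e(1) by (rule all_pairsE)
    obtain z w where zw: "e' = {z, w}" "z \<in> R" "w \<in> R" "z \<noteq> w" using e(2) by (rule all_pairsE)
    \<comment> \<open>On a transversal an edge is determined by its two parts, so the first
      component of the colour already separates edges.\<close>
    have "h ` e = h ` e'"
      using eq col(1)[OF xy(2-4)] col(1)[OF zw(2-4)] xy zw by (simp add: set_encode_eq_iff)
    moreover have "e \<subseteq> R" "e' \<subseteq> R" using xy zw by auto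
    ultimately show "e = e'" using inj_on_image_eq_iff[OF hinj, of e e'] by simp
  qed
  ultimately show ?thesis using ginj im by blast
qed

section \<open>Choice of the core\<close>

theorem theorem1p3:
  fixes F :: "'a graph"
  assumes "simple_graph F"
    and "\<nexists>v. isolated_vertex v F"
    and "\<exists>H. isolated_edge H F"
  shows "\<exists>c::nat. \<exists>N::nat. \<forall>n\<ge>N. rsat n F \<le> enat c"
proof -
  obtain a b where ab: "a \<noteq> b" "a \<in> verts F" "b \<in> verts F" "{a, b} \<in> edges F"
    and rest: "edges F - {{a, b}} \<subseteq> all_pairs (verts F - {a, b})"
    using assms(1,3) isolated_edge_ends by metis
  define R where "R = verts F - {a, b}"
  have finF: "finite (verts F)" using assms(1) by (simp add: simple_graph_def)
  then have finR: "finite R" by (simp add: R_def)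
  show ?thesis
  proof (cases "edges F - {{a, b}} = all_pairs R")
    case True
    show ?thesis
    proof (rule rsat_bounded_of_robust_core
        [OF assms(1,2) ab(1,4) R_def rest[folded R_def] cocktail_edges_subset])
      show "\<nexists>f. rainbow_emb F (Graph {..<2 * card R} (cocktail_edges (card R)))
          cocktail_coloring f"
        using cocktail_core_free[OF assms(1) ab(1,4) R_def True] by blast
    qed (unfold True, rule cocktail_core_robust[OF finR])
  next
    case False
    have cardF: "card (verts F) = Suc (Suc (card R))"
      unfolding R_def using ab finF
      by (metis DiffI card.remove Diff_insert2 finite_Diff singletonD insertE empty_iff)
    show ?thesis
    proof (rule rsat_bounded_of_robust_core
        [OF assms(1,2) ab(1,4) R_def rest[folded R_def] order_refl])
      \<comment> \<open>The clique has one vertex fewer than \<open>F\<close>.\<close>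
      show "\<nexists>f. rainbow_emb F (Graph {..<Suc (card R)} (all_pairs {..<Suc (card R)}))
          set_encode f"
      proof
        assume "\<exists>f. rainbow_emb F (Graph {..<Suc (card R)} (all_pairs {..<Suc (card R)}))
          set_encode f"
        then have "card (verts F) \<le> card {..<Suc (card R)}"
          unfolding rainbow_emb_def graph.sel by (metis card_inj_on_le finite_lessThan)
        then show False using cardF by simp
      qed
    qed (rule clique_core_robust[OF finR psubsetI[OF rest[folded R_def] False]])
  qed
qed

end
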